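(* Let $G$ be either of the graphs $G_a$, $G_b$ defined in the context, and let $n'$ be its number of vertices. Then $(\lambda,\mathbf{v},\mathbf{u})$ is a Jordan chain for $K(G)$, where $\lambda=\sqrt{2}\,i$ and $\mathbf{v},\mathbf{u}\in\mathbb{C}^{2n'}$ are given by $$\mathbf{v}_j=\begin{cases}1&j=1\\-1&j=2\\-\lambda/2&j=3\\ \lambda/2&j=4\\0&\text{else}\end{cases}\quad \mathbf{v}_{n'+j}=\begin{cases}\lambda/2&j=1\\-\lambda/2&j=2\\1/2&j=3\\-1/2&j=4\\0&\text{else}\end{cases}\quad \mathbf{u}_j=\begin{cases}\lambda&j=1\\-\lambda&j=2\\-1/2&j=3\\1/2&j=4\\0&\text{else}\end{cases}\quad \mathbf{u}_{n'+j}=\begin{cases}-3/2&j=1\\3/2&j=2\\0&j=3\\0&j=4\\0&\text{else}\end{cases}$$ for each vertex $j$ of $G$.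
   Context: For a simple graph $G$ on vertices $1,\dots,n'$ with adjacency matrix $A$ and diagonal degree matrix $D$, $K(G)=\begin{bmatrix} A & D-I_{n'}\\ -I_{n'} & 0\end{bmatrix}$. Jordan chain: let $(\lambda,\mathbf{u}^{(1)})$ be an eigenpair for a matrix $N$, let $\mathbf{u}^{(0)}$ be the zero vector, and let $k$ be the largest integer such that the system $(N-\lambda I)\mathbf{u}^{(j+1)}=\mathbf{u}^{(j)}$ has a solution for all $j\in\{0,1,\dots,k-1\}$. The sequence $\mathbf{u}^{(1)},\dots,\mathbf{u}^{(k)}$ is a Jordan chain of length $k$ of $N$ for $\lambda$. "$(\lambda,\mathbf{v},\mathbf{u})$ is a Jordan chain for $K(G)$" means that $\mathbf{u}^{(1)}=\mathbf{v}$, $\mathbf{u}^{(2)}=\mathbf{u}$ is a Jordan chain (of length $2$) of $K(G)$ for the eigenvalue $\lambda$; in particular $\mathbf{v}\ne 0$, $K(G)\mathbf{v}=\lambda\mathbf{v}$ and $K(G)\mathbf{u}=\lambda\mathbf{u}+\mathbf{v}$. $G_a$ is the graph on the $8$ vertices $1,\dots,8$ with edges $\{1,4\}$, $\{2,3\}$, $\{1,5\}$, $\{2,5\}$, $\{3,5\}$, $\{4,5\}$, $\{3,6\}$, $\{4,6\}$, $\{3,7\}$, $\{4,7\}$, $\{3,8\}$, $\{4,8\}$. $G_b$ is the graph on the $9$ vertices $1,\dots,9$ with edges $\{1,4\}$, $\{2,3\}$, $\{1,5\}$, $\{2,5\}$, $\{3,6\}$, $\{4,6\}$, $\{3,7\}$,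 $\{4,7\}$, $\{3,8\}$, $\{4,8\}$, $\{3,9\}$, $\{4,9\}$. *)

theory Defs
  imports "Jordan_Normal_Form.Char_Poly"
begin

text \<open>Graphs on the vertex set \<open>{1..order G}\<close>; an edge is a two-element set of vertices.\<close>

record graph =
  order :: nat
  edges :: "nat set set"

definition simple_graph :: "graph \<Rightarrow> bool" where
  "simple_graph G \<longleftrightarrow>
     (\<forall>e \<in> edges G. \<exists>i \<in> {1..order G}. \<exists>j \<in> {1..order G}. i \<noteq> j \<and> e = {i, j})"

definition degree :: "graph \<Rightarrow> nat \<Rightarrow> nat" where
  "degree G i = card {j \<in> {1..order G}. {i, j} \<in> edges G}"

text \<open>Rows, columns and vector entries are indexed from 0, so that index \<open>i\<close> belongs to
  vertex \<open>i + 1\<close>.\<close>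

definition adjacency_mat :: "graph \<Rightarrow> complex mat" where
  "adjacency_mat G =
     mat (order G) (order G) (\<lambda>(i, j). if {i + 1, j + 1} \<in> edges G then 1 else 0)"

definition degree_mat :: "graph \<Rightarrow> complex mat" where
  "degree_mat G =
     mat (order G) (order G) (\<lambda>(i, j). if i = j then of_nat (degree G (i + 1)) else 0)"

definition K_mat :: "graph \<Rightarrow> complex mat" where
  "K_mat G =
     four_block_mat
       (adjacency_mat G) (degree_mat G - 1\<^sub>m (order G))
       (- 1\<^sub>m (order G)) (0\<^sub>m (order G) (order G))"

text \<open>A list \<open>[u1, \<dots>, uk]\<close> satisfies the Jordan system if \<open>(N - \<lambda> I) u(j+1) = uj\<close>
  for \<open>0 \<le> j < k\<close>, where \<open>u0\<close> is the zero vector.\<close>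

definition jordan_system :: "complex mat \<Rightarrow> complex \<Rightarrow> complex vec list \<Rightarrow> bool" where
  "jordan_system N lam us \<longleftrightarrow>
     set us \<subseteq> carrier_vec (dim_row N) \<and>
     (\<forall>j < length us.
        (N - lam \<cdot>\<^sub>m 1\<^sub>m (dim_row N)) *\<^sub>v ((0\<^sub>v (dim_row N) # us) ! (j + 1))
          = (0\<^sub>v (dim_row N) # us) ! j)"

text \<open>The length of a Jordan chain is the largest \<open>k\<close> for which the system is solvable
  starting from the given eigenvector; the last clause therefore ranges over all solutions
  with that first vector, not only over extensions of \<open>us\<close>.\<close>

definition jordan_chain :: "complex mat \<Rightarrow> complex \<Rightarrow> complex vec list \<Rightarrow> bool" where
  "jordan_chain N lam us \<longleftrightarrow>
     square_mat N \<and> us \<noteq> [] \<and> eigenvector N (hd us) lam \<and> jordan_system N lam us \<and>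
     (\<forall>ws. ws \<noteq> [] \<and> hd ws = hd us \<and> jordan_system N lam ws \<longrightarrow> length ws \<le> length us)"

definition G_a :: graph where
  "G_a = \<lparr> order = 8,
     edges = {{1,4}, {2,3}, {1,5}, {2,5}, {3,5}, {4,5},
              {3,6}, {4,6}, {3,7}, {4,7}, {3,8}, {4,8}} \<rparr>"

definition G_b :: graph where
  "G_b = \<lparr> order = 9,
     edges = {{1,4}, {2,3}, {1,5}, {2,5}, {3,6}, {4,6},
              {3,7}, {4,7}, {3,8}, {4,8}, {3,9}, {4,9}} \<rparr>"

lemma simple_graph_pairI:
  "i \<in> {1..n} \<Longrightarrow> j \<in> {1..n} \<Longrightarrow> i \<noteq> j \<Longrightarrow>
     \<exists>i' \<in> {1..n}. \<exists>j' \<in> {1..n}. i' \<noteq> j' \<and> {i, j} = {i', j'}" for i j n :: nat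
  by blast

lemma simple_graph_G_a: "simple_graph G_a"
  unfolding simple_graph_def G_a_def graph.simps ball_simps
  by (intro conjI TrueI simple_graph_pairI; simp)

lemma simple_graph_G_b: "simple_graph G_b"
  unfolding simple_graph_def G_b_def graph.simps ball_simps
  by (intro conjI TrueI simple_graph_pairI; simp)

end

theory Submission
  imports Defs
begin

text \<open>
  Why the pair is a Jordan chain, and why the chain stops at length two.

  \<^emph>\<open>The equations.\<close> The permutation exchanging \<open>1\<close> with \<open>2\<close> and \<open>3\<close> with \<open>4\<close> is an automorphism
  of both graphs. The functions on the vertices that change sign under it vanish outside
  \<open>{1, 2, 3, 4}\<close>, have the form \<open>(p, -p, q, -q, 0, ..., 0)\<close>, and are preserved by \<open>A\<close> and \<open>D\<close>.
  On the coordinates \<open>(p, q)\<close> the matrix \<open>A\<close> acts as \<open>(p, q) \<mapsto> (-q, -p)\<close>, and \<open>D - I\<close> as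
  \<open>(p, q) \<mapsto> (p, 4 q)\<close>, in both graphs alike. Hence \<open>K(G)\<close> induces the same \<open>4 \<times> 4\<close> matrix in
  both cases (lemma \<open>K_mat_mult_odd\<close>), and \<open>K v = \<lambda> v\<close> and \<open>K u = \<lambda> u + v\<close> become identities
  that follow from \<open>\<lambda>\<^sup>2 = -2\<close>.

  \<^emph>\<open>Maximality.\<close> A longer chain may begin with \<open>v\<close> and continue with any vector \<open>x\<close> in place of
  \<open>u\<close>, so it does not suffice to see that \<open>u\<close> itself cannot be continued. The obstruction is a
  bilinear form. For every graph, the matrix \<open>S = K_form G\<close> with
  blocks \<open>0, I, I, A\<close> satisfies
  \<open>K\<^sup>T S = S K\<close> (lemma \<open>K_mat_symmetrizer\<close>), so \<open>K - \<lambda> I\<close> is self-adjoint for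
  \<open>B(x, y) = x\<^sup>T S y\<close>. If \<open>v = (K - \<lambda> I)\<^sup>2 w\<close>, then
  \<open>B(u, v) = B((K - \<lambda> I)\<^sup>2 u, w) = B((K - \<lambda> I) v, w) = 0\<close> (lemma \<open>chain_form_eq_0\<close>). The given
  vectors have \<open>B(u, v) = -4\<close>.
\<close>

section \<open>A self-adjointness criterion for Jordan chains of length two\<close>

lemma shift_mult_vec_eq_iff:
  fixes N :: "complex mat"
  assumes N: "N \<in> carrier_mat m m" and x: "x \<in> carrier_vec m" and y: "y \<in> carrier_vec m"
  shows "(N - lam \<cdot>\<^sub>m 1\<^sub>m m) *\<^sub>v x = y \<longleftrightarrow> N *\<^sub>v x = lam \<cdot>\<^sub>v x + y"
proof -
  have "(lam \<cdot>\<^sub>m 1\<^sub>m m) *\<^sub>v x = lam \<cdot>\<^sub>v x"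
    using x by (intro eq_vecI) auto
  then have "(N - lam \<cdot>\<^sub>m 1\<^sub>m m) *\<^sub>v x = N *\<^sub>v x - lam \<cdot>\<^sub>v x"
    using N x by (simp add: minus_mult_distrib_mat_vec[of _ m m])
  moreover have "N *\<^sub>v x - lam \<cdot>\<^sub>v x = y \<longleftrightarrow> N *\<^sub>v x = lam \<cdot>\<^sub>v x + y"
  proof
    assume "N *\<^sub>v x - lam \<cdot>\<^sub>v x = y"
    then show "N *\<^sub>v x = lam \<cdot>\<^sub>v x + y"
      using N x by (intro eq_vecI) auto
  next
    assume "N *\<^sub>v x = lam \<cdot>\<^sub>v x + y"
    then show "N *\<^sub>v x - lam \<cdot>\<^sub>v x = y"
      using x y by (intro eq_vecI) auto
  qed
  ultimately show ?thesis by simp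
qed

text \<open>Both \<open>u\<close> and \<open>x\<close> may follow \<open>v\<close> in a chain. Moving \<open>N\<close> across the form once gives
  \<open>B(u, v) = B(v, x)\<close>, and moving it a second time shows that \<open>B(v, x)\<close> is zero if \<open>x\<close> has a
  successor \<open>w\<close>, because \<open>v\<close> is an eigenvector.\<close>

lemma chain_form_eq_0:
  fixes N S :: "'a :: comm_ring_1 mat"
  assumes N: "N \<in> carrier_mat m m" and S: "S \<in> carrier_mat m m"
    and sym: "transpose_mat N * S = S * N"
    and v: "v \<in> carrier_vec m" and u: "u \<in> carrier_vec m"
    and x: "x \<in> carrier_vec m" and w: "w \<in> carrier_vec m"
    and Nv: "N *\<^sub>v v = lam \<cdot>\<^sub>v v" and Nu: "N *\<^sub>v u = lam \<cdot>\<^sub>v u + v"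
    and Nx: "N *\<^sub>v x = lam \<cdot>\<^sub>v x + v" and Nw: "N *\<^sub>v w = lam \<cdot>\<^sub>v w + x"
  shows "u \<bullet> (S *\<^sub>v v) = 0"
proof -
  define B where "B a b = a \<bullet> (S *\<^sub>v b)" for a b
  have NT: "transpose_mat N \<in> carrier_mat m m"
    using N by simp
  have adj: "B a (N *\<^sub>v b) = B (N *\<^sub>v a) b"
    if a: "a \<in> carrier_vec m" and b: "b \<in> carrier_vec m" for a b
  proof -
    have Sb: "S *\<^sub>v b \<in> carrier_vec m"
      using S b by simp
    have "B a (N *\<^sub>v b) = a \<bullet> ((S * N) *\<^sub>v b)"
      using S N b by (simp add: B_def)
    also have "\<dots> = a \<bullet> (transpose_mat N *\<^sub>v (S *\<^sub>v b))"
      using S NT b by (simp flip: sym)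
    also have "\<dots> = B (N *\<^sub>v a) b"
      using transpose_vec_mult_scalar[OF NT Sb a] by (simp add: B_def)
    finally show ?thesis .
  qed
  have add_right: "B a (lam \<cdot>\<^sub>v b + c) = lam * B a b + B a c"
    if "a \<in> carrier_vec m" "b \<in> carrier_vec m" "c \<in> carrier_vec m" for a b c
  proof -
    have "S *\<^sub>v (lam \<cdot>\<^sub>v b) = lam \<cdot>\<^sub>v (S *\<^sub>v b)"
      using S that by (intro eq_vecI) auto
    then show ?thesis
      using S that
      by (simp add: B_def mult_add_distrib_mat_vec[OF S] scalar_prod_add_distrib[of _ m])
  qed
  have add_left: "B (lam \<cdot>\<^sub>v b + c) a = lam * B b a + B c a"
    if "a \<in> carrier_vec m" "b \<in> carrier_vec m" "c \<in> carrier_vec m" for a b c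
    using S that by (simp add: B_def add_scalar_prod_distrib[of _ m])
  have "lam * B u x + B u v = lam * B u x + B v x"
    using adj[OF u x] u v x by (simp add: Nx Nu add_right add_left)
  moreover have "lam * B v w + B v x = lam * B v w"
  proof -
    have "B (lam \<cdot>\<^sub>v v) w = lam * B v w"
      using S v w by (simp add: B_def)
    then show ?thesis
      using adj[OF v w] v w x by (simp add: Nw Nv add_right)
  qed
  ultimately show ?thesis by (simp add: B_def)
qed

lemma jordan_chain_pairI:
  assumes N: "N \<in> carrier_mat m m" and S: "S \<in> carrier_mat m m"
    and sym: "transpose_mat N * S = S * N"
    and v: "v \<in> carrier_vec m" and u: "u \<in> carrier_vec m"
    and Nv: "N *\<^sub>v v = lam \<cdot>\<^sub>v v" and Nu: "N *\<^sub>v u = lam \<cdot>\<^sub>v u + v"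
    and nz: "u \<bullet> (S *\<^sub>v v) \<noteq> 0"
  shows "jordan_chain N lam [v, u]"
proof -
  have dim: "dim_row N = m" "dim_col N = m"
    using N by auto
  note shift = shift_mult_vec_eq_iff[OF N]
  have v0: "v \<noteq> 0\<^sub>v m"
  proof
    assume "v = 0\<^sub>v m"
    then have "S *\<^sub>v v = 0\<^sub>v m"
      using S by (intro eq_vecI) auto
    with nz u show False by simp
  qed
  have sys: "jordan_system N lam [v, u]"
    using v u Nv Nu by (auto simp: jordan_system_def dim shift less_Suc_eq)
  have "length ws \<le> 2" if ws: "ws \<noteq> []" "hd ws = v" "jordan_system N lam ws" for ws
  proof (rule ccontr)
    assume "\<not> length ws \<le> 2"
    with ws obtain x w rest where eq: "ws = v # x # w # rest"
      by (cases ws; cases "tl ws"; cases "tl (tl ws)") auto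
    have x: "x \<in> carrier_vec m" and w: "w \<in> carrier_vec m"
      using ws(3) by (auto simp: jordan_system_def eq dim)
    have step: "(N - lam \<cdot>\<^sub>m 1\<^sub>m m) *\<^sub>v ((0\<^sub>v m # ws) ! (j + 1)) = (0\<^sub>v m # ws) ! j"
      if "j < length ws" for j
      using ws(3) that by (simp add: jordan_system_def dim)
    have "N *\<^sub>v x = lam \<cdot>\<^sub>v x + v"
      using step[of 1] x v by (simp add: eq shift)
    moreover have "N *\<^sub>v w = lam \<cdot>\<^sub>v w + x"
      using step[of 2] x w by (simp add: eq shift)
    ultimately show False
      using chain_form_eq_0[OF N S sym v u x w Nv Nu] nz by simp
  qed
  then show ?thesis
    using v v0 Nv sys by (auto simp: jordan_chain_def eigenvector_def dim numeral_2_eq_2)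
qed

section \<open>The form for which \<open>K(G)\<close> is self-adjoint\<close>

definition K_form :: "graph \<Rightarrow> complex mat" where
  "K_form G =
     four_block_mat (0\<^sub>m (order G) (order G)) (1\<^sub>m (order G)) (1\<^sub>m (order G)) (adjacency_mat G)"

lemma adjacency_mat_carrier [simp]: "adjacency_mat G \<in> carrier_mat (order G) (order G)"
  by (simp add: adjacency_mat_def)

lemma degree_mat_carrier [simp]: "degree_mat G \<in> carrier_mat (order G) (order G)"
  by (simp add: degree_mat_def)

lemma K_mat_carrier [simp]: "K_mat G \<in> carrier_mat (order G + order G) (order G + order G)"
  unfolding K_mat_def by (intro four_block_carrier_mat) simp_all

lemma K_form_carrier [simp]: "K_form G \<in> carrier_mat (order G + order G) (order G + order G)"
  unfolding K_form_def by (intro four_block_carrier_mat) simp_all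

lemma transpose_adjacency_mat: "transpose_mat (adjacency_mat G) = adjacency_mat G"
  by (intro eq_matI) (auto simp: adjacency_mat_def insert_commute)

lemma transpose_degree_mat: "transpose_mat (degree_mat G) = degree_mat G"
  by (intro eq_matI) (auto simp: degree_mat_def)

text \<open>Eliminating the upper block \<open>x\<close> from \<open>K (x, z) = \<lambda> (x, z)\<close> leaves
  \<open>(\<lambda>\<^sup>2 I - \<lambda> A + D - I) z = 0\<close>. All coefficients of this quadratic equation are symmetric, so
  left and right eigenvectors of \<open>K\<close> correspond to each other; \<open>K_form G\<close> is that
  correspondence. In block form both sides of the equation are diagonal with blocks \<open>-I\<close> and \<open>D - I\<close>.\<close>

lemma K_mat_symmetrizer: "transpose_mat (K_mat G) * K_form G = K_form G * K_mat G"
proof -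
  let ?n = "order G" and ?A = "adjacency_mat G" and ?E = "degree_mat G - 1\<^sub>m (order G)"
  let ?I = "1\<^sub>m ?n :: complex mat" and ?O = "0\<^sub>m ?n ?n :: complex mat"
  have E: "?E \<in> carrier_mat ?n ?n"
    by (intro minus_carrier_mat) simp
  have ET: "transpose_mat ?E = ?E"
    by (subst transpose_minus[of _ ?n ?n]) (simp_all add: transpose_degree_mat)
  have "transpose_mat (K_mat G) = four_block_mat ?A (- ?I) ?E ?O"
    unfolding K_mat_def
    by (subst transpose_four_block_mat[of _ ?n ?n _ ?n _ ?n])
      (use E in \<open>simp_all add: ET transpose_adjacency_mat transpose_uminus\<close>)
  then have "transpose_mat (K_mat G) * K_form G =
      four_block_mat (?A * ?O + - ?I * ?I) (?A * ?I + - ?I * ?A) (?E * ?O + ?O * ?I) (?E * ?I + ?O * ?A)"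
    unfolding K_form_def
    by (simp only:, subst mult_four_block_mat[of _ ?n ?n _ ?n _ ?n _ _ ?n _ ?n]) (use E in simp_all)
  moreover have "K_form G * K_mat G =
      four_block_mat (?O * ?A + ?I * - ?I) (?O * ?E + ?I * ?O) (?I * ?A + ?A * - ?I) (?I * ?E + ?A * ?O)"
    unfolding K_form_def K_mat_def
    by (subst mult_four_block_mat[of _ ?n ?n _ ?n _ ?n _ _ ?n _ ?n]) (use E in simp_all)
  moreover have "- ?I * ?A = - ?A" "?A * - ?I = - ?A" "- ?I * ?I = - ?I" "?I * - ?I = - ?I"
    by (simp_all add: carrier_matD[OF adjacency_mat_carrier])
  moreover have "?A + - ?A = ?O"
    by (intro eq_matI) (simp_all add: carrier_matD[OF adjacency_mat_carrier])
  ultimately show ?thesis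
    using E by (simp add: left_mult_one_mat[OF adjacency_mat_carrier]
        right_mult_one_mat[OF adjacency_mat_carrier] left_mult_zero_mat[OF adjacency_mat_carrier]
        right_mult_zero_mat[OF adjacency_mat_carrier])
qed

section \<open>Vectors that are odd under the symmetry of the two graphs\<close>

text \<open>The functions on the vertices that change sign under the exchange of \<open>1\<close> with \<open>2\<close> and of
  \<open>3\<close> with \<open>4\<close>, by their values \<open>p\<close> at vertex \<open>1\<close> and \<open>q\<close> at vertex \<open>3\<close>. Vertex \<open>i + 1\<close> has
  index \<open>i\<close>.\<close>

definition odd_vec :: "nat \<Rightarrow> complex \<Rightarrow> complex \<Rightarrow> complex vec" where
  "odd_vec n p q = vec n (\<lambda>i. if i = 0 then p else if i = 1 then - p
                               else if i = 2 then q else if i = 3 then - q else 0)"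

lemma odd_vec_carrier [simp]: "odd_vec n p q \<in> carrier_vec n"
  by (simp add: odd_vec_def)

lemma dim_odd_vec [simp]: "dim_vec (odd_vec n p q) = n"
  by (simp add: odd_vec_def)

lemma odd_vec_add: "odd_vec n p q + odd_vec n r s = odd_vec n (p + r) (q + s)"
  by (intro eq_vecI) (auto simp: odd_vec_def)

lemma odd_vec_uminus: "- odd_vec n p q = odd_vec n (- p) (- q)"
  by (intro eq_vecI) (auto simp: odd_vec_def)

lemma odd_vec_smult: "c \<cdot>\<^sub>v odd_vec n p q = odd_vec n (c * p) (c * q)"
  by (intro eq_vecI) (auto simp: odd_vec_def)

lemma append_vec_smult: "c \<cdot>\<^sub>v (x @\<^sub>v y) = (c \<cdot>\<^sub>v x) @\<^sub>v (c \<cdot>\<^sub>v y)"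
  by (intro eq_vecI) auto

lemma scalar_prod_odd_vec_right:
  assumes n: "4 \<le> n"
  shows "w \<bullet> odd_vec n p q = p * (w $ 0 - w $ 1) + q * (w $ 2 - w $ 3)"
proof -
  have "w \<bullet> odd_vec n p q = (\<Sum>i\<in>{0..<4}. w $ i * odd_vec n p q $ i)"
    unfolding scalar_prod_def dim_odd_vec using n
    by (intro sum.mono_neutral_right) (auto simp: odd_vec_def)
  also have "\<dots> = p * (w $ 0 - w $ 1) + q * (w $ 2 - w $ 3)"
    using n by (simp add: odd_vec_def eval_nat_numeral algebra_simps)
  finally show ?thesis .
qed

lemma scalar_prod_odd_vec:
  assumes "4 \<le> n"
  shows "odd_vec n p q \<bullet> odd_vec n r s = 2 * (p * r + q * s)"
  using assms by (simp add: scalar_prod_odd_vec_right) (simp add: odd_vec_def algebra_simps)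

text \<open>The only edges inside \<open>{1, 2, 3, 4}\<close> are \<open>{1, 4}\<close> and \<open>{2, 3}\<close>. Every other vertex is fixed
  by the symmetry, so the contributions of its neighbours cancel in pairs.\<close>

lemma adjacency_mat_mult_odd:
  assumes G: "G = G_a \<or> G = G_b" and n: "n = order G"
  shows "adjacency_mat G *\<^sub>v odd_vec n p q = odd_vec n (- q) (- p)"
proof (intro eq_vecI)
  have n4: "4 \<le> n"
    using G n by (auto simp: G_a_def G_b_def)
  fix i assume "i < dim_vec (odd_vec n (- q) (- p))"
  then have i: "i < n" by simp
  define a where "a j = (if {i + 1, j + 1} \<in> edges G then 1 else 0 :: complex)" for j
  have "(adjacency_mat G *\<^sub>v odd_vec n p q) $ i = p * (a 0 - a 1) + q * (a 2 - a 3)"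
    using i n4 by (simp add: adjacency_mat_def n scalar_prod_odd_vec_right a_def)
  also have "\<dots> = odd_vec n (- q) (- p) $ i"
    using G
  proof
    assume Ga: "G = G_a"
    then have "i < 8"
      using i n by (simp add: G_a_def)
    then have "i = 0 \<or> i = 1 \<or> i = 2 \<or> i = 3 \<or> i = 4 \<or> i = 5 \<or> i = 6 \<or> i = 7"
      by linarith
    then show ?thesis
      using i by (elim disjE) (simp_all add: odd_vec_def a_def Ga G_a_def doubleton_eq_iff)
  next
    assume Gb: "G = G_b"
    then have "i < 9"
      using i n by (simp add: G_b_def)
    then have "i = 0 \<or> i = 1 \<or> i = 2 \<or> i = 3 \<or> i = 4 \<or> i = 5 \<or> i = 6 \<or> i = 7 \<or> i = 8"
      by linarith
    then show ?thesis
      using i by (elim disjE) (simp_all add: odd_vec_def a_def Gb G_b_def doubleton_eq_iff)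
  qed
  finally show "(adjacency_mat G *\<^sub>v odd_vec n p q) $ i = odd_vec n (- q) (- p) $ i" .
qed (simp add: n adjacency_mat_def)

lemma degrees_G_a: "degree G_a 1 = 2" "degree G_a 2 = 2" "degree G_a 3 = 5" "degree G_a 4 = 5"
proof -
  have "{j \<in> {1..order G_a}. {1, j} \<in> edges G_a} = {4, 5}"
    "{j \<in> {1..order G_a}. {2, j} \<in> edges G_a} = {3, 5}"
    "{j \<in> {1..order G_a}. {3, j} \<in> edges G_a} = {2, 5, 6, 7, 8}"
    "{j \<in> {1..order G_a}. {4, j} \<in> edges G_a} = {1, 5, 6, 7, 8}"
    by (auto simp: G_a_def doubleton_eq_iff)
  then show "degree G_a 1 = 2" "degree G_a 2 = 2" "degree G_a 3 = 5" "degree G_a 4 = 5"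
    by (simp_all add: Defs.degree_def)
qed

lemma degrees_G_b: "degree G_b 1 = 2" "degree G_b 2 = 2" "degree G_b 3 = 5" "degree G_b 4 = 5"
proof -
  have "{j \<in> {1..order G_b}. {1, j} \<in> edges G_b} = {4, 5}"
    "{j \<in> {1..order G_b}. {2, j} \<in> edges G_b} = {3, 5}"
    "{j \<in> {1..order G_b}. {3, j} \<in> edges G_b} = {2, 6, 7, 8, 9}"
    "{j \<in> {1..order G_b}. {4, j} \<in> edges G_b} = {1, 6, 7, 8, 9}"
    by (auto simp: G_b_def doubleton_eq_iff)
  then show "degree G_b 1 = 2" "degree G_b 2 = 2" "degree G_b 3 = 5" "degree G_b 4 = 5"
    by (simp_all add: Defs.degree_def)
qed

lemma degree_mat_mult_vec:
  assumes x: "x \<in> carrier_vec (order G)" and i: "i < order G"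
  shows "(degree_mat G *\<^sub>v x) $ i = of_nat (degree G (i + 1)) * x $ i"
proof -
  have "(degree_mat G *\<^sub>v x) $ i =
      (\<Sum>j\<in>{0..<order G}. (if i = j then of_nat (degree G (i + 1)) else 0) * x $ j)"
    using x i by (simp add: degree_mat_def scalar_prod_def)
  also have "\<dots> = (\<Sum>j\<in>{0..<order G}. if i = j then of_nat (degree G (i + 1)) * x $ j else 0)"
    by (rule sum.cong) auto
  also have "\<dots> = of_nat (degree G (i + 1)) * x $ i"
    using i by simp
  finally show ?thesis .
qed

lemma degree_mat_mult_odd:
  assumes G: "G = G_a \<or> G = G_b" and n: "n = order G"
  shows "degree_mat G *\<^sub>v odd_vec n p q = odd_vec n (2 * p) (5 * q)"
proof (intro eq_vecI)
  fix i assume "i < dim_vec (odd_vec n (2 * p) (5 * q))"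
  then have i: "i < order G" by (simp add: n)
  have deg: "degree G 1 = 2" "degree G 2 = 2" "degree G 3 = 5" "degree G 4 = 5"
    using G by (elim disjE; simp only: degrees_G_a degrees_G_b)+
  then show "(degree_mat G *\<^sub>v odd_vec n p q) $ i = odd_vec n (2 * p) (5 * q) $ i"
    using i by (simp add: degree_mat_mult_vec n odd_vec_def deg[unfolded One_nat_def] numeral_2_eq_2[symmetric])
qed (simp add: n degree_mat_def)

lemma K_mat_mult_odd:
  assumes G: "G = G_a \<or> G = G_b" and n: "n = order G"
  shows "K_mat G *\<^sub>v (odd_vec n p q @\<^sub>v odd_vec n r s) =
         odd_vec n (r - q) (4 * s - p) @\<^sub>v odd_vec n (- p) (- q)"
proof -
  have "(degree_mat G - 1\<^sub>m n) *\<^sub>v odd_vec n r s = odd_vec n (2 * r) (5 * s) - odd_vec n r s"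
    using degree_mat_mult_odd[OF G n]
    by (subst minus_mult_distrib_mat_vec[of _ n n]) (simp_all add: n)
  also have "\<dots> = odd_vec n r (4 * s)"
    by (intro eq_vecI) (auto simp: odd_vec_def)
  finally have E: "(degree_mat G - 1\<^sub>m n) *\<^sub>v odd_vec n r s = odd_vec n r (4 * s)" .
  have "K_mat G *\<^sub>v (odd_vec n p q @\<^sub>v odd_vec n r s) =
      (adjacency_mat G *\<^sub>v odd_vec n p q + (degree_mat G - 1\<^sub>m n) *\<^sub>v odd_vec n r s) @\<^sub>v
      (- 1\<^sub>m n *\<^sub>v odd_vec n p q + 0\<^sub>m n n *\<^sub>v odd_vec n r s)"
    unfolding K_mat_def n[symmetric]
    by (subst four_block_mat_mult_vec[of _ n n _ n _ n]) (auto simp: n intro!: minus_carrier_mat)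
  moreover have "0\<^sub>m n n *\<^sub>v odd_vec n r s = odd_vec n 0 0"
    by (intro eq_vecI) (auto simp: odd_vec_def)
  ultimately show ?thesis
    using adjacency_mat_mult_odd[OF G n] by (simp add: E odd_vec_add odd_vec_uminus)
qed

lemma K_form_mult_odd:
  assumes G: "G = G_a \<or> G = G_b" and n: "n = order G"
  shows "K_form G *\<^sub>v (odd_vec n p q @\<^sub>v odd_vec n r s) =
         odd_vec n r s @\<^sub>v odd_vec n (p - s) (q - r)"
proof -
  have "K_form G *\<^sub>v (odd_vec n p q @\<^sub>v odd_vec n r s) =
      (0\<^sub>m n n *\<^sub>v odd_vec n p q + 1\<^sub>m n *\<^sub>v odd_vec n r s) @\<^sub>v
      (1\<^sub>m n *\<^sub>v odd_vec n p q + adjacency_mat G *\<^sub>v odd_vec n r s)"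
    unfolding K_form_def n[symmetric]
    by (subst four_block_mat_mult_vec[of _ n n _ n _ n]) (simp_all add: n)
  moreover have "0\<^sub>m n n *\<^sub>v odd_vec n p q = odd_vec n 0 0"
    by (intro eq_vecI) (auto simp: odd_vec_def)
  ultimately show ?thesis
    using adjacency_mat_mult_odd[OF G n] by (simp add: odd_vec_add)
qed

section \<open>The Jordan chain\<close>

lemma eq_append_odd_vecI:
  assumes x: "x \<in> carrier_vec (2 * n)"
    and top: "\<And>j. j \<in> {1..n} \<Longrightarrow> x $ (j - 1) =
           (if j = 1 then p else if j = 2 then - p
            else if j = 3 then q else if j = 4 then - q else 0)"
    and bot: "\<And>j. j \<in> {1..n} \<Longrightarrow> x $ (n + j - 1) =
           (if j = 1 then r else if j = 2 then - r
            else if j = 3 then s else if j = 4 then - s else 0)"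
  shows "x = odd_vec n p q @\<^sub>v odd_vec n r s"
proof (intro eq_vecI)
  fix i assume "i < dim_vec (odd_vec n p q @\<^sub>v odd_vec n r s)"
  then have i: "i < n + n" by simp
  show "x $ i = (odd_vec n p q @\<^sub>v odd_vec n r s) $ i"
  proof (cases "i < n")
    case True
    then show ?thesis using top[of "i + 1"] by (simp add: odd_vec_def)
  next
    case False
    then show ?thesis using bot[of "i - n + 1"] i by (simp add: odd_vec_def)
  qed
qed (use x in simp)

theorem proposition4p4:
  fixes G :: graph and n' :: nat and lam :: complex and v u :: "complex vec"
  assumes "G = G_a \<or> G = G_b"
    and "n' = order G"
    and "lam = complex_of_real (sqrt 2) * \<i>"
    and "v \<in> carrier_vec (2 * n')"
    and "u \<in> carrier_vec (2 * n')"
    and "\<And>j. j \<in> {1..n'} \<Longrightarrow> v $ (j - 1) =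
           (if j = 1 then 1 else if j = 2 then - 1
            else if j = 3 then - lam / 2 else if j = 4 then lam / 2 else 0)"
    and "\<And>j. j \<in> {1..n'} \<Longrightarrow> v $ (n' + j - 1) =
           (if j = 1 then lam / 2 else if j = 2 then - lam / 2
            else if j = 3 then 1 / 2 else if j = 4 then - 1 / 2 else 0)"
    and "\<And>j. j \<in> {1..n'} \<Longrightarrow> u $ (j - 1) =
           (if j = 1 then lam else if j = 2 then - lam
            else if j = 3 then - 1 / 2 else if j = 4 then 1 / 2 else 0)"
    and "\<And>j. j \<in> {1..n'} \<Longrightarrow> u $ (n' + j - 1) =
           (if j = 1 then - 3 / 2 else if j = 2 then 3 / 2
            else if j = 3 then 0 else if j = 4 then 0 else 0)"
  shows "jordan_chain (K_mat G) lam [v, u]"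
proof -
  have n4: "4 \<le> n'"
    using assms(1,2) by (auto simp: G_a_def G_b_def)
  have lam2: "lam * lam = - 2"
  proof -
    have "lam * lam = - complex_of_real (sqrt 2 * sqrt 2)"
      by (simp add: assms(3) algebra_simps flip: of_real_mult)
    then show ?thesis by simp
  qed
  have v: "v = odd_vec n' 1 (- lam / 2) @\<^sub>v odd_vec n' (lam / 2) (1 / 2)"
    by (rule eq_append_odd_vecI[OF assms(4)]) (simp_all only: assms(6,7), simp_all)
  have u: "u = odd_vec n' lam (- 1 / 2) @\<^sub>v odd_vec n' (- 3 / 2) 0"
    by (rule eq_append_odd_vecI[OF assms(5)]) (simp_all only: assms(8,9), simp_all)
  note K = K_mat_mult_odd[OF assms(1,2)]
  have Kv: "K_mat G *\<^sub>v v = lam \<cdot>\<^sub>v v"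
    by (simp add: v K append_vec_smult odd_vec_smult lam2)
  have "lam \<cdot>\<^sub>v u + v =
      odd_vec n' (lam * lam + 1) (- lam) @\<^sub>v odd_vec n' (- lam) (1 / 2)"
    unfolding u v append_vec_smult odd_vec_smult
    by (subst append_vec_add[of _ n' _ _ n']) (simp_all add: odd_vec_add field_simps)
  then have Ku: "K_mat G *\<^sub>v u = lam \<cdot>\<^sub>v u + v"
    by (simp add: u K lam2)
  have "u \<bullet> (K_form G *\<^sub>v v) =
      (odd_vec n' lam (- 1 / 2) @\<^sub>v odd_vec n' (- 3 / 2) 0) \<bullet>
      (odd_vec n' (lam / 2) (1 / 2) @\<^sub>v odd_vec n' (1 - 1 / 2) (- lam / 2 - lam / 2))"
    by (simp only: u v K_form_mult_odd[OF assms(1,2)])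
  also have "\<dots> = lam * lam - 2"
    using n4 by (subst scalar_prod_append[of _ n' _ n'])
      (simp_all add: scalar_prod_odd_vec algebra_simps)
  also have "\<dots> = - 4"
    by (simp add: lam2)
  finally have nz: "u \<bullet> (K_form G *\<^sub>v v) \<noteq> 0" by simp
  have dims: "v \<in> carrier_vec (order G + order G)" "u \<in> carrier_vec (order G + order G)"
    using assms(2,4,5) by (simp_all add: mult_2)
  show ?thesis
    by (rule jordan_chain_pairI[OF K_mat_carrier K_form_carrier K_mat_symmetrizer dims Kv Ku nz])
qed

end
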